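(* Let $V_a$ be a finite nonempty set of positive values $v_a^h$, indexed by $h$, let $I_a\in\{0,1\}$, let $cv_a:(0,\infty)\to(0,\infty)$ be a differentiable cumulative conversion function, and let $\{k_h\cdot cv_a\}_h$ be a linear decomposition of $cv_a$, i.e. $k_h\ge 0$ are constants with $\sum_h k_h=1$. Let $cpa_a^h:(0,\infty)\to\mathbb{R}$ be the CPA function in sub-market $h$, for each $h$, such that the aggregate CPA $\sum_h k_h\cdot cpa_a^h(\gamma_a)$ is differentiable and strictly positive. If $$\sum_h v_a^h\cdot k_h=(1+\gamma_a)\cdot\sum_h cpa_a^h(\gamma_a)\cdot k_h\quad\text{for all }\gamma_a>0$$ and the function $\gamma_a\mapsto\frac{1+\gamma_a-I_a}{1+\gamma_a}\cdot cv_a(\gamma_a)$ is non-increasing on $(0,\infty)$, then the delivery mechanism $\{(cpa_a^h,k_h\cdot cv_a)\}_h$ is incentive-compatible and individually rational.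
   Context: An advertiser $a$ has a private target return on investment (ROI) $\gamma_a>0$. The type parameter $I_a\in\{0,1\}$ is $0$ for a revenue-maximizing advertiser and $1$ for a profit-maximizing one. The set $R_a$ of ad requests matched to $a$ is the disjoint union of sub-markets $R_a^h$, where $R_a^h$ consists of the ad requests in which a conversion is worth $v_a^h>0$ to her. The other advertisers' bids are held fixed, so the delivery depends only on the report of $a$. The delivery mechanism $\{(cpa_a^h,k_h\cdot cv_a)\}_h$ means: when $a$ reports $\gamma_a'>0$ she receives in $R_a^h$ a total of $k_h\cdot cv_a(\gamma_a')$ expected conversions at average cost per conversion $cpa_a^h(\gamma_a')$. Standing assumption (intensive auction market): the total conversions $cv_a$ and the overall average cost per conversion $\sum_h k_h\cdot cpa_a^h$ are differentiable and strictly positive. Utility (whole market): the ROI delivered under report $\gamma_a'$ is $\frac{\sum_h(v_a^h-cpa_a^h(\gamma_a'))\,k_h\,cv_a(\gamma_a')}{\sum_h cpa_a^h(\gamma_a')\,k_h\,cv_a(\gamma_a')}$. The utility of an advertiser with true target $\gamma_a$ who reports $\gamma_a'$ is $\sum_h(v_a^h-I_a\cdot cpa_a^h(\gamma_a'))\cdot k_h\cdot cv_a(\gamma_a')$ if this ROI is $\ge\gamma_a$, and is a negative number otherwise. Incentive-compatible: for all true $\gamma_a>0$ and all reports $\gamma_a'>0$, the utility from reporting $\gamma_a$ is at least the utility from reporting $\gamma_a'$. Individually rational: for all $\gamma_a>0$, the utility of an advertiser with true target $\gamma_a$ from reporting $\gamma_a$ is $\ge 0$. *)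

theory Defs
  imports "HOL-Analysis.Analysis"
begin

text \<open>
  A delivery mechanism over sub-markets \<open>h \<in> H\<close> is a pair of families: \<open>cpa h r\<close> is the average
  cost per conversion and \<open>conv h r\<close> the total expected conversions delivered in sub-market \<open>h\<close>
  when the advertiser reports the target ROI \<open>r > 0\<close>. Only positive reports are meaningful.
\<close>

definition delivered_roi ::
  "'h set \<Rightarrow> ('h \<Rightarrow> real) \<Rightarrow> ('h \<Rightarrow> real \<Rightarrow> real) \<Rightarrow> ('h \<Rightarrow> real \<Rightarrow> real) \<Rightarrow> real \<Rightarrow> real" where
  "delivered_roi H v cpa conv r =
     (\<Sum>h\<in>H. (v h - cpa h r) * conv h r) / (\<Sum>h\<in>H. cpa h r * conv h r)"

text \<open>
  \<open>I\<close> is 0 for a revenue maximizer and 1 for a profit maximizer; \<open>t\<close> is the true target ROI and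
  \<open>r\<close> the reported one. When the true target is missed, the utility is some negative number
  that the model leaves unspecified: \<open>pen t r\<close>, an arbitrary function that is negative for
  positive arguments (to be assumed where the utility is used).
\<close>

definition utility ::
  "'h set \<Rightarrow> ('h \<Rightarrow> real) \<Rightarrow> real \<Rightarrow> (real \<Rightarrow> real \<Rightarrow> real) \<Rightarrow>
   ('h \<Rightarrow> real \<Rightarrow> real) \<Rightarrow> ('h \<Rightarrow> real \<Rightarrow> real) \<Rightarrow> real \<Rightarrow> real \<Rightarrow> real" where
  "utility H v I pen cpa conv t r =
     (if delivered_roi H v cpa conv r \<ge> t
      then (\<Sum>h\<in>H. (v h - I * cpa h r) * conv h r)
      else pen t r)"

definition incentive_compatible ::
  "'h set \<Rightarrow> ('h \<Rightarrow> real) \<Rightarrow> real \<Rightarrow> (real \<Rightarrow> real \<Rightarrow> real) \<Rightarrow>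
   ('h \<Rightarrow> real \<Rightarrow> real) \<Rightarrow> ('h \<Rightarrow> real \<Rightarrow> real) \<Rightarrow> bool" where
  "incentive_compatible H v I pen cpa conv \<longleftrightarrow>
     (\<forall>t>0. \<forall>r>0. utility H v I pen cpa conv t t \<ge> utility H v I pen cpa conv t r)"

definition individually_rational ::
  "'h set \<Rightarrow> ('h \<Rightarrow> real) \<Rightarrow> real \<Rightarrow> (real \<Rightarrow> real \<Rightarrow> real) \<Rightarrow>
   ('h \<Rightarrow> real \<Rightarrow> real) \<Rightarrow> ('h \<Rightarrow> real \<Rightarrow> real) \<Rightarrow> bool" where
  "individually_rational H v I pen cpa conv \<longleftrightarrow>
     (\<forall>t>0. utility H v I pen cpa conv t t \<ge> 0)"

end

theory Submission
  imports Defs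
begin

text \<open>
  Under the pricing condition the ROI delivered for a report \<open>r\<close> is exactly \<open>r\<close>, so a report
  \<open>r < t\<close> misses the true target and is penalized. For a report \<open>r \<ge> t\<close> the utility is the
  constant \<open>\<Sum>h. v h * k h\<close> times \<open>(1 + r - I) / (1 + r) * cv r\<close>, which is largest at \<open>r = t\<close>.
\<close>

text \<open>The pricing condition makes value minus cost equal to \<open>r\<close> times cost, and
  the common factor \<open>cv r\<close> cancels. The two positivity assumptions keep the denominator
  nonzero.\<close>

lemma delivered_roi_eq_report:
  fixes cv :: "real \<Rightarrow> real"
  assumes "cv r > 0" and "(\<Sum>h\<in>H. cpa h r * k h) > 0"
    and "(\<Sum>h\<in>H. v h * k h) = (1 + r) * (\<Sum>h\<in>H. cpa h r * k h)"
  shows "delivered_roi H v cpa (\<lambda>h r. k h * cv r) r = r"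
proof -
  let ?C = "\<Sum>h\<in>H. cpa h r * k h"
  have "(\<Sum>h\<in>H. (v h - cpa h r) * (k h * cv r)) = ((\<Sum>h\<in>H. v h * k h) - ?C) * cv r"
    \<comment> \<open>The right-hand side is first collected into one sum; the summands then agree
      by algebra.\<close>
    by (simp add: sum_distrib_right flip: sum_subtractf) (simp add: algebra_simps)
  also have "\<dots> = r * (?C * cv r)"
    using assms(3) by (simp add: algebra_simps)
  finally have num: "(\<Sum>h\<in>H. (v h - cpa h r) * (k h * cv r)) = r * (?C * cv r)" .
  have "(\<Sum>h\<in>H. cpa h r * (k h * cv r)) = ?C * cv r"
    by (simp add: sum_distrib_right mult.assoc)
  with num assms(1,2) show ?thesis
    by (simp add: delivered_roi_def)
qed

text \<open>Pricing fixes the average cost as total value over \<open>1 + r\<close>, so eliminating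
  it leaves \<open>r\<close> only in the factor assumed to be non-increasing.\<close>

lemma gain_eq:
  fixes cv :: "real \<Rightarrow> real"
  assumes "r > 0"
    and "(\<Sum>h\<in>H. v h * k h) = (1 + r) * (\<Sum>h\<in>H. cpa h r * k h)"
  shows "(\<Sum>h\<in>H. (v h - I * cpa h r) * (k h * cv r)) =
         (\<Sum>h\<in>H. v h * k h) * ((1 + r - I) / (1 + r) * cv r)"
proof -
  let ?C = "\<Sum>h\<in>H. cpa h r * k h"
  have "(\<Sum>h\<in>H. (v h - I * cpa h r) * (k h * cv r)) = ((\<Sum>h\<in>H. v h * k h) - I * ?C) * cv r"
    by (simp add: sum_distrib_left sum_distrib_right flip: sum_subtractf) (simp add: algebra_simps)
  also have "\<dots> = (1 + r - I) * ?C * cv r"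
    using assms(2) by (simp add: algebra_simps)
  \<comment> \<open>The factor \<open>1 + r\<close> is inserted so that pricing can replace
    \<open>(1 + r) * ?C\<close> by the value sum.\<close>
  also have "\<dots> = (1 + r) * ?C * ((1 + r - I) / (1 + r) * cv r)"
    using assms(1) by simp
  finally show ?thesis
    using assms(2) by simp
qed

theorem theorem3:
  fixes H :: "'h set"
    and v k :: "'h \<Rightarrow> real"
    and I :: real
    and pen :: "real \<Rightarrow> real \<Rightarrow> real"
    and cv :: "real \<Rightarrow> real"
    and cpa :: "'h \<Rightarrow> real \<Rightarrow> real"
  assumes "finite H" and "H \<noteq> {}"
    and "\<And>h. h \<in> H \<Longrightarrow> v h > 0"
    and "I \<in> {0, 1}"
    and "\<And>t r. t > 0 \<Longrightarrow> r > 0 \<Longrightarrow> pen t r < 0"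
    and "\<And>r. r > 0 \<Longrightarrow> cv r > 0"
    and "cv differentiable_on {0<..}"
    and "\<And>h. h \<in> H \<Longrightarrow> k h \<ge> 0"
    and "(\<Sum>h\<in>H. k h) = 1"
    and "\<And>r. r > 0 \<Longrightarrow> (\<Sum>h\<in>H. k h * cpa h r) > 0"
    and "(\<lambda>r. \<Sum>h\<in>H. k h * cpa h r) differentiable_on {0<..}"
    and "\<And>r. r > 0 \<Longrightarrow> (\<Sum>h\<in>H. v h * k h) = (1 + r) * (\<Sum>h\<in>H. cpa h r * k h)"
    and "antimono_on {0<..} (\<lambda>r. (1 + r - I) / (1 + r) * cv r)"
  shows "incentive_compatible H v I pen cpa (\<lambda>h r. k h * cv r) \<and>
         individually_rational H v I pen cpa (\<lambda>h r. k h * cv r)"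
proof -
  let ?S = "\<Sum>h\<in>H. v h * k h"
  let ?f = "\<lambda>r. (1 + r - I) / (1 + r) * cv r"
  let ?U = "utility H v I pen cpa (\<lambda>h r. k h * cv r)"
  have C_pos: "(\<Sum>h\<in>H. cpa h r * k h) > 0" if "r > 0" for r
    using assms(10)[OF that] by (simp add: mult.commute)
  \<comment> \<open>\<open>?S\<close> does not depend on the report, so the pricing condition at the
    sample report 1 settles its sign.\<close>
  have S_pos: "?S > 0"
    using assms(12)[of 1] C_pos[of 1] by simp
  have U: "?U t r = (if t \<le> r then ?S * ?f r else pen t r)" if "r > 0" for t r
    using delivered_roi_eq_report[where cv = cv and k = k and cpa = cpa and r = r,
        OF assms(6)[OF that] C_pos[OF that] assms(12)[OF that]]
      gain_eq[where k = k and cpa = cpa and r = r, OF that assms(12)[OF that]]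
    unfolding utility_def by presburger
  \<comment> \<open>The numerator \<open>1 + r - I\<close> is \<open>1 + r\<close> or
    \<open>r\<close>, positive in both cases.\<close>
  have f_nonneg: "?f r \<ge> 0" if "r > 0" for r
    using that assms(4) assms(6)[OF that] by auto
  have rational: "?U t t \<ge> 0" if "t > 0" for t
    using U[OF that, of t] mult_nonneg_nonneg[OF less_imp_le[OF S_pos] f_nonneg[OF that]] by simp
  have "?U t t \<ge> ?U t r" if "t > 0" "r > 0" for t r
  proof (cases "t \<le> r")
    case True
    have "?f r \<le> ?f t"
      using monotone_onD[OF assms(13), of t r] that True by simp
    then have "?S * ?f r \<le> ?S * ?f t"
      using S_pos by (intro mult_left_mono) auto
    then show ?thesis
      using U[OF that(1), of t] U[OF that(2), of t] True by simp
  next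
    case False
    \<comment> \<open>Here individual rationality yields incentive compatibility: truth earns at
      least 0, under-reporting a negative penalty.\<close>
    then have "?U t r < 0"
      using U[OF that(2), of t] assms(5)[OF that] by simp
    then show ?thesis
      using rational[OF that(1)] by linarith
  qed
  with rational show ?thesis
    by (simp add: incentive_compatible_def individually_rational_def)
qed

end
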